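(* Fix a tone $k$, a user $n$, an approximation point $\tilde{\mathbf s}_k\in\mathcal S_k$ and a parameter value $\theta$. Suppose the univariate per-user objective decomposes on $\mathcal S_k^n$ as $$f_k(s_k^n;\tilde{\mathbf s}_k^{-n})=f_k^1(s_k^n;\tilde{\mathbf s}_k^{-n},\tilde{\mathbf s}_k,\theta)+f_k^2(s_k^n;\tilde{\mathbf s}_k^{-n},\tilde{\mathbf s}_k,\theta),$$ where $f_k^1\in\mathcal F^1$ and $f_k^2\in\mathcal F^2(\tilde{\mathbf s}_k)$. Define $$f_k^{\mathrm{app}}(s_k^n)=f_k^1(s_k^n)+d_k^n s_k^n+e_k^n,\qquad d_k^n=\frac{\partial f_k^2}{\partial s_k^n}(\tilde s_k^n),\quad e_k^n=f_k^2(\tilde s_k^n)-d_k^n\tilde s_k^n .$$ Then: (1) $f_k^{\mathrm{app}}(\tilde s_k^n)=f_k(\tilde s_k^n;\tilde{\mathbf s}_k^{-n})$; (2) $\dfrac{\partial}{\partial s_k^n}f_k^{\mathrm{app}}(\tilde s_k^n)=\dfrac{\partial}{\partial s_k^n}f_k(\tilde s_k^n;\tilde{\mathbf s}_k^{-n})$; (3) $f_k^{\mathrm{app}}(s_k^n)\ge f_k(s_k^n;\tilde{\mathbf s}_k^{-n})$ for all $s_k^n\in\mathcal S_k^n$; (4) for every $\lambda_n\ge 0$, the (possibly nonconvex) subproblem $$\min_{s_k^n\in\mathcal S_k^n}\left[f_k^{\mathrm{app}}(s_k^n)+\lambda_n s_k^n\right]$$ can be solved in closed form with a maximal computational cost equal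 to that of solving one cubic equation in one variable and performing five function evaluations of $f_k^{\mathrm{app}}$.
   Context: Users $\mathcal N=\{1,\dots,N\}$. On tone $k$, $\mathbf s_k=(s_k^1,\dots,s_k^N)$ are the transmit powers, $\mathbf s_k^{-n}$ is the vector of powers of all users except $n$, $\mathcal S_k^n=[0,s_k^{n,\mathrm{mask}}]$ with $s_k^{n,\mathrm{mask}}>0$, and $\mathcal S_k=\prod_n\mathcal S_k^n$. Constants: weights $w_n\ge0$, normalized channel gains $a_k^{n,m}\ge0$, noise powers $z_k^n>0$. Put $\mathrm{int}_k^n=\sum_{m\ne n}a_k^{n,m}s_k^m+z_k^n$. The objective is $$f_k(\mathbf s_k)=-\sum_{n\in\mathcal N}w_n\log\left(1+\frac{s_k^n}{\mathrm{int}_k^n}\right),$$ and $f_k(s_k^n;\tilde{\mathbf s}_k^{-n})$ denotes this function viewed as a function of the single variable $s_k^n\in\mathcal S_k^n$ with the other powers fixed at $\tilde{\mathbf s}_k^{-n}$. $\mathcal F^1$ is the set of univariate (differentiable) functions of $s_k^n$ on $\mathcal S_k^n$ whose derivative is a rational function of degree at most 3, i.e. of the form $$\frac{p_1(s_k^n)^3+p_2(s_k^n)^2+p_3s_k^n+p_4}{p_5(s_k^n)^3+p_6(s_k^n)^2+p_7s_k^n+p_8}$$ with constants $p_1,\dots,p_8$. $\mathcal F^2(\tilde{\mathbf s}_k)$ is the set of univariate functions of $s_k^n$ on $\mathcal S_k^n$, differentiable at $\tilde s_k^n$, that are upper bounded on $\mathcal S_k^n$ by their tangent linear (affine) approximation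 at $s_k^n=\tilde s_k^n$. Meaning of (4): a global minimizer is found by solving one polynomial equation of degree at most 3 in one variable, whose coefficients are explicit in $p_1,\dots,p_8$, $d_k^n$ and $\lambda_n$, determining from its solutions at most five points of $\mathcal S_k^n$, and comparing the objective values at these points. *)

theory Defs
  imports "HOL-Analysis.Analysis" "HOL-Computational_Algebra.Polynomial"
begin

type_synonym tone = nat
type_synonym user = nat
type_synonym powers = "user \<Rightarrow> real"

text \<open>
  The users are \<open>{1..N}\<close>; values of user-indexed functions outside this set never matter.
  \<open>a k n m\<close> is the normalized gain from user \<open>m\<close> into user \<open>n\<close> on tone \<open>k\<close>.
\<close>

definition power_range :: "(tone \<Rightarrow> user \<Rightarrow> real) \<Rightarrow> tone \<Rightarrow> user \<Rightarrow> real set" where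
  "power_range smask k n = {0..smask k n}"

definition power_region :: "(tone \<Rightarrow> user \<Rightarrow> real) \<Rightarrow> nat \<Rightarrow> tone \<Rightarrow> powers set" where
  "power_region smask N k = Pi {1..N} (power_range smask k)"

definition interference ::
  "nat \<Rightarrow> (tone \<Rightarrow> user \<Rightarrow> user \<Rightarrow> real) \<Rightarrow> (tone \<Rightarrow> user \<Rightarrow> real) \<Rightarrow> tone \<Rightarrow> user \<Rightarrow> powers \<Rightarrow> real"
where
  "interference N a z k n s = (\<Sum>m\<in>{1..N} - {n}. a k n m * s m) + z k n"

definition objective ::
  "nat \<Rightarrow> (user \<Rightarrow> real) \<Rightarrow> (tone \<Rightarrow> user \<Rightarrow> user \<Rightarrow> real) \<Rightarrow> (tone \<Rightarrow> user \<Rightarrow> real) \<Rightarrow> tone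
    \<Rightarrow> powers \<Rightarrow> real"
where
  "objective N w a z k s =
     - (\<Sum>n\<in>{1..N}. w n * ln (1 + s n / interference N a z k n s))"

definition objective_user ::
  "nat \<Rightarrow> (user \<Rightarrow> real) \<Rightarrow> (tone \<Rightarrow> user \<Rightarrow> user \<Rightarrow> real) \<Rightarrow> (tone \<Rightarrow> user \<Rightarrow> real) \<Rightarrow> tone
    \<Rightarrow> user \<Rightarrow> powers \<Rightarrow> real \<Rightarrow> real"
where
  "objective_user N w a z k n st x = objective N w a z k (st(n := x))"

text \<open>
  Univariate functions on \<open>S\<close> are total functions whose values off \<open>S\<close> are irrelevant, so all
  derivatives are taken within \<open>S\<close> (one-sided at the end points of an interval).  The denominator
  must not vanish on \<open>S\<close>: otherwise \<open>x / 0 = 0\<close> would admit functions whose derivative is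
  not given by the quotient.  Only the entries \<open>p 1, \<dots>, p 8\<close> are used.
\<close>

definition has_cubic_rational_deriv :: "(real \<Rightarrow> real) \<Rightarrow> (nat \<Rightarrow> real) \<Rightarrow> real set \<Rightarrow> bool" where
  "has_cubic_rational_deriv f p S \<longleftrightarrow>
     (\<forall>x\<in>S. p 5 * x^3 + p 6 * x^2 + p 7 * x + p 8 \<noteq> 0 \<and>
        (f has_real_derivative
           (p 1 * x^3 + p 2 * x^2 + p 3 * x + p 4) / (p 5 * x^3 + p 6 * x^2 + p 7 * x + p 8))
          (at x within S))"

definition F1 :: "real set \<Rightarrow> (real \<Rightarrow> real) set" where
  "F1 S = {f. \<exists>p. has_cubic_rational_deriv f p S}"

definition F2 :: "real set \<Rightarrow> real \<Rightarrow> (real \<Rightarrow> real) set" where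
  "F2 S x0 = {f. \<exists>D. (f has_real_derivative D) (at x0 within S) \<and>
                     (\<forall>x\<in>S. f x \<le> f x0 + D * (x - x0))}"

text \<open>
  Clearing denominators in the stationarity condition of \<open>fapp x + lam * x\<close>, whose derivative is
  \<open>P x / Q x + d + lam\<close> with cubics \<open>P\<close>, \<open>Q\<close> as above, gives \<open>P x + (d + lam) * Q x = 0\<close>.
\<close>

definition stationarity_poly :: "(nat \<Rightarrow> real) \<Rightarrow> real \<Rightarrow> real \<Rightarrow> real poly" where
  "stationarity_poly p d lam =
     [: p 4 + (d + lam) * p 8, p 3 + (d + lam) * p 7, p 2 + (d + lam) * p 6, p 1 + (d + lam) * p 5 :]"

text \<open>
  The points to be compared, determined from the solution set \<open>R\<close> of that equation.  The set \<open>R\<close>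
  is infinite only if the polynomial is zero; the objective is then constant on the interval.
\<close>

definition candidates :: "real \<Rightarrow> real set \<Rightarrow> real set" where
  "candidates M R = {0, M} \<union> (if finite R then R \<inter> {0..M} else {})"

end

theory Submission
  imports Defs
begin

text \<open>
  Parts (1) to (3) hold because \<open>fapp\<close> replaces \<open>f2\<close> by its tangent at \<open>st n\<close>.  For (4), the
  objective \<open>g\<close> of the subproblem is differentiable on a compact interval, so it has a minimizer
  there; a minimizer that is not an end point is a root of the stationarity polynomial.  If that
  polynomial is nonzero, its at most three roots and the two end points suffice; if it vanishes
  identically, \<open>g\<close> is constant.
\<close>

text \<open>Comparing values on \<open>C\<close> only yields a minimizer over \<open>C\<close>.
  Since the minimum over \<open>S\<close> is attained at \<open>m\<close> in \<open>C\<close>, the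
  two minimal values coincide.\<close>

lemma is_arg_min_superset:
  fixes g :: "'a \<Rightarrow> 'b::linorder"
  assumes "C \<subseteq> S" and "m \<in> C" and "\<And>y. y \<in> S \<Longrightarrow> g m \<le> g y"
    and "is_arg_min g (\<lambda>y. y \<in> C) x"
  shows "is_arg_min g (\<lambda>y. y \<in> S) x"
  using assms unfolding is_arg_min_linorder by (meson order_trans subsetD)

lemma has_real_derivative_zero_constant_Icc:
  fixes g :: "real \<Rightarrow> real"
  assumes "\<And>x. x \<in> {a..b} \<Longrightarrow> (g has_real_derivative 0) (at x within {a..b})"
    and "x \<in> {a..b}" and "y \<in> {a..b}"
  shows "g x = g y"
  using has_field_derivative_zero_constant[of "{a..b}" g] assms by (metis convex_real_interval(5))

text \<open>Strictly between the end points, the derivative within the interval is an ordinary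
  two-sided one, so Fermat's rule applies.\<close>

lemma interior_min_deriv_zero:
  fixes g :: "real \<Rightarrow> real"
  assumes "(g has_real_derivative D) (at x within {a..b})"
    and "a < x" and "x < b" and "\<And>y. y \<in> {a..b} \<Longrightarrow> g x \<le> g y"
  shows "D = 0"
proof -
  have "(g has_real_derivative D) (at x)"
    using assms(1-3) by (simp add: at_within_Icc_at)
  \<comment> \<open>The radius \<open>min (x - a) (b - x)\<close> keeps the neighbourhood of
    \<open>x\<close> inside the interval, where minimality is known.\<close>
  then show ?thesis
    using assms(2-4) by (intro DERIV_local_min[of g D x "min (x - a) (b - x)"]) (auto simp: abs_less_iff)
qed

lemma poly_stationarity_poly:
  "poly (stationarity_poly p d lam) x =
     (p 1 * x^3 + p 2 * x^2 + p 3 * x + p 4)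
       + (d + lam) * (p 5 * x^3 + p 6 * x^2 + p 7 * x + p 8)"
  by (simp add: stationarity_poly_def algebra_simps power2_eq_square power3_eq_cube)

lemma degree_stationarity_poly: "degree (stationarity_poly p d lam) \<le> 3"
  by (simp add: stationarity_poly_def)

lemma finite_candidates: "finite (candidates M R)"
  by (simp add: candidates_def)

lemma candidates_subset: "0 \<le> M \<Longrightarrow> candidates M R \<subseteq> {0..M}"
  by (auto simp: candidates_def)

text \<open>Two end points plus at most three roots; an infinite root set contributes nothing to
  \<open>candidates\<close>.\<close>

lemma card_candidates_roots:
  assumes "degree c \<le> 3"
  shows "card (candidates M {x. poly c x = 0}) \<le> 5"
proof -
  let ?R = "{x. poly c x = 0}"
  have two: "card {0, M} \<le> 2"
    by (simp add: card_insert_if)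
  show ?thesis
  proof (cases "finite ?R")
    case True
    \<comment> \<open>The zero polynomial would have all of the reals as its root set.\<close>
    then have "c \<noteq> 0" using infinite_UNIV_char_0[where 'a=real] by auto
    then have "card ?R \<le> 3"
      using card_poly_roots_bound[of c] assms by simp
    moreover have "card (?R \<inter> {0..M}) \<le> card ?R"
      using True by (simp add: card_mono)
    moreover have "card ({0, M} \<union> (?R \<inter> {0..M})) \<le> card {0, M} + card (?R \<inter> {0..M})"
      by (rule card_Un_le)
    ultimately show ?thesis
      using two True unfolding candidates_def by simp
  next
    case False
    then show ?thesis
      using two unfolding candidates_def by simp
  qed
qed

text \<open>Only the zeros of \<open>g'\<close> on the interval matter, so \<open>g'\<close> may be
  any function that shares them with a polynomial \<open>c\<close>. This lets a rational derivative
  be replaced by its cleared numerator.\<close>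

lemma candidates_contain_minimizer:
  fixes g g' :: "real \<Rightarrow> real"
  assumes M: "0 \<le> M"
    and deriv: "\<And>x. x \<in> {0..M} \<Longrightarrow> (g has_real_derivative g' x) (at x within {0..M})"
    and root: "\<And>x. x \<in> {0..M} \<Longrightarrow> g' x = 0 \<longleftrightarrow> poly c x = 0"
  shows "\<exists>m\<in>candidates M {x. poly c x = 0}. \<forall>y\<in>{0..M}. g m \<le> g y"
proof (cases "c = 0")
  case True
  then have "(g has_real_derivative 0) (at x within {0..M})" if "x \<in> {0..M}" for x
    using deriv[OF that] root[OF that] by simp
  then have "g 0 = g y" if "y \<in> {0..M}" for y
    using has_real_derivative_zero_constant_Icc[of 0 M g 0 y] M that by simp
  \<comment> \<open>Every point is now a minimizer; \<open>0\<close> is a candidate whatever the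
    root set is.\<close>
  then show ?thesis
    by (intro bexI[of _ 0]) (auto simp: candidates_def)
next
  case False
  have "continuous_on {0..M} g"
    using DERIV_continuous_on deriv by blast
  then obtain m where m: "m \<in> {0..M}" and min: "\<And>y. y \<in> {0..M} \<Longrightarrow> g m \<le> g y"
    using continuous_attains_inf[of "{0..M}" g] M by auto
  have "poly c m = 0" if "m \<noteq> 0" "m \<noteq> M"
    using interior_min_deriv_zero[OF deriv[OF m] _ _ min] root[OF m] m that by simp
  \<comment> \<open>Since \<open>c\<close> is nonzero its root set is finite, so
    \<open>candidates\<close> does retain the roots in the interval.\<close>
  then have "m \<in> candidates M {x. poly c x = 0}"
    using m poly_roots_finite[OF False] by (auto simp: candidates_def)
  then show ?thesis
    using min by blast
qed

text \<open>Membership in \<open>F2\<close> only provides some slope \<open>D\<close>. On a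
  nondegenerate interval the derivative within it is unique, even at an end point, so
  \<open>D\<close> is the slope \<open>d\<close> given by \<open>vector_derivative\<close>.\<close>

lemma F2_tangent:
  assumes "g \<in> F2 {a..b} x0" and "x0 \<in> {a..b}" and "a < b"
    and "d = vector_derivative g (at x0 within {a..b})"
  shows "(g has_real_derivative d) (at x0 within {a..b})"
    and "\<And>x. x \<in> {a..b} \<Longrightarrow> g x \<le> g x0 + d * (x - x0)"
proof -
  obtain D where D: "(g has_real_derivative D) (at x0 within {a..b})"
    and le: "\<forall>x\<in>{a..b}. g x \<le> g x0 + D * (x - x0)"
    using assms(1) unfolding F2_def by blast
  have "d = D"
    using vector_derivative_within_cbox[of a b x0 g D] assms(2-4) D
    by (simp add: has_real_derivative_iff_has_vector_derivative)
  then show "(g has_real_derivative d) (at x0 within {a..b})"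
    and "\<And>x. x \<in> {a..b} \<Longrightarrow> g x \<le> g x0 + d * (x - x0)"
    using D le by auto
qed

theorem mainTheorem1:
  fixes N :: nat and k :: tone and n :: user
    and w :: "user \<Rightarrow> real"
    and a :: "tone \<Rightarrow> user \<Rightarrow> user \<Rightarrow> real"
    and z smask :: "tone \<Rightarrow> user \<Rightarrow> real"
    and st :: powers and \<theta> :: 'theta
    and f1 f2 :: "powers \<Rightarrow> 'theta \<Rightarrow> real \<Rightarrow> real"
    and S :: "real set" and f fapp :: "real \<Rightarrow> real" and d e :: real
  assumes user: "n \<in> {1..N}"
    and weights: "\<And>m. m \<in> {1..N} \<Longrightarrow> w m \<ge> 0"
    and gains: "\<And>m l. m \<in> {1..N} \<Longrightarrow> l \<in> {1..N} \<Longrightarrow> a k m l \<ge> 0"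
    and noise: "\<And>m. m \<in> {1..N} \<Longrightarrow> z k m > 0"
    and masks: "\<And>m. m \<in> {1..N} \<Longrightarrow> smask k m > 0"
    and point: "st \<in> power_region smask N k"
    and S_eq: "S = power_range smask k n"
    and f_eq: "f = objective_user N w a z k n st"
    and decomposition: "\<And>x. x \<in> S \<Longrightarrow> f x = f1 st \<theta> x + f2 st \<theta> x"
    and f1_class: "f1 st \<theta> \<in> F1 S"
    and f2_class: "f2 st \<theta> \<in> F2 S (st n)"
    and d_eq: "d = vector_derivative (f2 st \<theta>) (at (st n) within S)"
    and e_eq: "e = f2 st \<theta> (st n) - d * st n"
    and fapp_eq: "fapp = (\<lambda>x. f1 st \<theta> x + d * x + e)"
  shows "fapp (st n) = f (st n) \<and>
     (\<exists>D. (fapp has_real_derivative D) (at (st n) within S) \<and>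
             (f has_real_derivative D) (at (st n) within S)) \<and>
     (\<forall>x\<in>S. fapp x \<ge> f x) \<and>
     (\<forall>lam\<ge>0. \<forall>p. has_cubic_rational_deriv (f1 st \<theta>) p S \<longrightarrow>
           (let c = stationarity_poly p d lam;
                C = candidates (smask k n) {x. poly c x = 0};
                g = (\<lambda>x. fapp x + lam * x)
            in degree c \<le> 3 \<and> C \<subseteq> S \<and> C \<noteq> {} \<and> finite C \<and> card C \<le> 5 \<and>
               (\<forall>x. is_arg_min g (\<lambda>y. y \<in> C) x \<longrightarrow> is_arg_min g (\<lambda>y. y \<in> S) x)))"
proof -
  let ?M = "smask k n" and ?f1 = "f1 st \<theta>" and ?f2 = "f2 st \<theta>"
  have M: "0 < ?M" using masks user by blast
  have S: "S = {0..?M}" using S_eq by (simp add: power_range_def)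
  have stS: "st n \<in> S" using point user S_eq by (auto simp: power_region_def)
  note tangent = F2_tangent[of ?f2 0 ?M "st n" d, folded S, OF f2_class stS M d_eq]
  obtain D1 where D1: "(?f1 has_real_derivative D1) (at (st n) within S)"
    using f1_class stS unfolding F1_def has_cubic_rational_deriv_def by blast
  \<comment> \<open>The choice of \<open>e\<close> turns \<open>d * x + e\<close> into the tangent
    of \<open>f2\<close> at \<open>st n\<close>.\<close>
  have touch: "fapp (st n) = f (st n)"
    using decomposition[OF stS] by (simp add: fapp_eq e_eq)
  have "((\<lambda>x. ?f1 x + ?f2 x) has_real_derivative D1 + d) (at (st n) within S)"
    using D1 tangent(1) by (rule DERIV_add)
  \<comment> \<open>The decomposition of \<open>f\<close> is known on \<open>S\<close> only, which
    suffices for a derivative within \<open>S\<close>; the radius 1 is arbitrary.\<close>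
  then have "(f has_real_derivative D1 + d) (at (st n) within S)"
    by (rule has_field_derivative_transform_within[of _ _ _ _ 1]) (simp_all add: stS decomposition)
  moreover have "(fapp has_real_derivative D1 + d) (at (st n) within S)"
    unfolding fapp_eq using D1 by (auto intro!: derivative_eq_intros)
  moreover have "fapp x \<ge> f x" if "x \<in> S" for x
    using tangent(2)[OF that] decomposition[OF that] by (simp add: fapp_eq e_eq algebra_simps)
  moreover have "let c = stationarity_poly p d lam;
                C = candidates ?M {x. poly c x = 0};
                g = (\<lambda>x. fapp x + lam * x)
            in degree c \<le> 3 \<and> C \<subseteq> S \<and> C \<noteq> {} \<and> finite C \<and> card C \<le> 5 \<and>
               (\<forall>x. is_arg_min g (\<lambda>y. y \<in> C) x \<longrightarrow> is_arg_min g (\<lambda>y. y \<in> S) x)"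
    if p: "has_cubic_rational_deriv ?f1 p S" for lam p
  proof -
    define c where "c = stationarity_poly p d lam"
    define C where "C = candidates ?M {x. poly c x = 0}"
    define g where "g = (\<lambda>x. fapp x + lam * x)"
    define P where "P x = p 1 * x^3 + p 2 * x^2 + p 3 * x + p 4" for x
    define Q where "Q x = p 5 * x^3 + p 6 * x^2 + p 7 * x + p 8" for x
    have Q: "Q x \<noteq> 0" and PQ: "(?f1 has_real_derivative P x / Q x) (at x within S)"
      if "x \<in> S" for x
      using p that unfolding has_cubic_rational_deriv_def P_def Q_def by auto
    have "(g has_real_derivative P x / Q x + d + lam) (at x within S)" if "x \<in> S" for x
      unfolding g_def fapp_eq using PQ[OF that] by (auto intro!: derivative_eq_intros)
    moreover have "P x / Q x + d + lam = 0 \<longleftrightarrow> poly c x = 0" if "x \<in> S" for x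
    proof -
      \<comment> \<open>The denominator \<open>Q\<close> has no zero on \<open>S\<close>, so
        multiplying by it neither adds nor loses stationary points.\<close>
      have "poly c x = Q x * (P x / Q x + d + lam)"
        using Q[OF that] unfolding c_def poly_stationarity_poly P_def[symmetric] Q_def[symmetric]
        by (simp add: field_simps)
      then show ?thesis using Q[OF that] by simp
    qed
    ultimately have "\<exists>m\<in>C. \<forall>y\<in>S. g m \<le> g y"
      using candidates_contain_minimizer[of ?M g "\<lambda>x. P x / Q x + d + lam" c] M
      unfolding C_def S by simp
    moreover have CS: "C \<subseteq> S"
      unfolding C_def S using M by (simp add: candidates_subset)
    ultimately have "is_arg_min g (\<lambda>y. y \<in> S) x" if "is_arg_min g (\<lambda>y. y \<in> C) x" for x
      using is_arg_min_superset[OF CS _ _ that] by auto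
    then have "\<forall>x. is_arg_min g (\<lambda>y. y \<in> C) x \<longrightarrow> is_arg_min g (\<lambda>y. y \<in> S) x"
      by simp
    moreover have deg: "degree c \<le> 3"
      unfolding c_def by (rule degree_stationarity_poly)
    moreover have "C \<noteq> {}" "finite C" "card C \<le> 5"
      using card_candidates_roots[OF deg] finite_candidates
      unfolding C_def by (auto simp: candidates_def)
    ultimately show ?thesis
      using CS unfolding Let_def c_def[symmetric] C_def[symmetric] g_def[symmetric] by (intro conjI)
  qed
  ultimately show ?thesis
    using touch by blast
qed

end
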